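(* Let $\boldsymbol{f}^n \in \mathbb{R}_+^N$ with $\|\boldsymbol{f}^n\|_1 = V$, let $\boldsymbol{f}(t_{n+1})$ be the exact solution at time $t_{n+1}$ of the ODE system started from $\boldsymbol{f}^n$ at time $t_n$ (see context), and let $\boldsymbol{f}^{n+1}$ be a numerical approximation produced by a positive and conservative scheme, i.e. $\boldsymbol{f}^{n+1} \in \mathbb{R}_+^N$ and $\|\boldsymbol{f}^{n+1}\|_1 = \|\boldsymbol{f}(t_{n+1})\|_1 = V$. Suppose that $\eta(\boldsymbol{f}^{n+1}) > \eta(\boldsymbol{f}^n)$ and that $\beta \in (0,1]$ satisfies $$\eta\big(\boldsymbol{f}^{n+1} + \beta(\boldsymbol{1} - \boldsymbol{f}^{n+1})\big) = \eta(\boldsymbol{f}(t_{n+1})).$$ If $f_i^{n+1} \ge C_0 > 0$ holds for all $1 \le i \le N$, then $$\|\beta(\boldsymbol{1} - \boldsymbol{f}^{n+1})\|_2 \le M\, \|\boldsymbol{f}(t_{n+1}) - \boldsymbol{f}^{n+1}\|_2,$$ where $M > 0$ is a constant which depends only on $C_0$, $\|\boldsymbol{f}^{n+1}\|_\infty$ and $\|\boldsymbol{f}(t_{n+1})\|_\infty$.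
   Context: $N \ge 1$ is an integer, $\Delta v_1,\dots,\Delta v_N > 0$ are fixed weights, $V = \sum_{i=1}^N \Delta v_i$, $\boldsymbol{1} = (1,\dots,1)^T$, and $\mathbb{R}_+ = [0,\infty)$. Norms are weighted: $\|\boldsymbol{f}\|_p = \big(\sum_{i=1}^N |f_i|^p \Delta v_i\big)^{1/p}$ for $p=1,2$, and $\|\boldsymbol{f}\|_\infty = \max_i |f_i|$. The Gibbs entropy is $\eta(\boldsymbol{f}) = \sum_{i=1}^N f_i \log f_i\, \Delta v_i$, with $0\log 0 = 0$. The ODE system is $\frac{\mathrm{d} f_i}{\mathrm{d}t} = Q_i(\boldsymbol{f}(t))$, $i=1,\dots,N$. It is assumed that its solutions (with nonnegative initial data) have the properties: conservation of mass, $\frac{\mathrm{d}}{\mathrm{d}t}\sum_i f_i(t)\Delta v_i = 0$; nonnegativity, $f_i(t) \ge 0$; monotonicity of entropy, $\frac{\mathrm{d}}{\mathrm{d}t}\sum_i f_i(t)\log f_i(t)\Delta v_i \le 0$, i.e. $\eta(\boldsymbol{f}(t))$ is nonincreasing in $t$. Here $t_n < t_{n+1}$ and $\boldsymbol{f}(t)$ denotes the solution with $\boldsymbol{f}(t_n) = \boldsymbol{f}^n$; in particular $\eta(\boldsymbol{f}(t_{n+1})) \le \eta(\boldsymbol{f}^n)$. All vectors are normalized so that the weighted average of their components is $1$, i.e. $\|\cdot\|_1 = V$. *)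

theory Defs
  imports Complex_Main "Jordan_Normal_Form.Matrix"
begin

text \<open>
  Vectors in $R^N$ are elements of \<^term>\<open>carrier_vec N :: real vec set\<close>, with components
  indexed by \<open>0, \<dots>, N - 1\<close>; this allows \<open>N\<close> to be quantified inside a formula. The weights
  are a function \<open>dv\<close>, of which only the values at \<open>i < N\<close> matter.
\<close>

definition nonneg_vecs :: "nat \<Rightarrow> real vec set" where
  "nonneg_vecs N = {f \<in> carrier_vec N. \<forall>i<N. 0 \<le> f $ i}"

definition ones_vec :: "nat \<Rightarrow> real vec" where
  "ones_vec N = vec N (\<lambda>_. 1)"

definition wnorm :: "real \<Rightarrow> (nat \<Rightarrow> real) \<Rightarrow> real vec \<Rightarrow> real" where
  "wnorm p dv f = (\<Sum>i<dim_vec f. \<bar>f $ i\<bar> powr p * dv i) powr (1 / p)"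

definition maxnorm :: "real vec \<Rightarrow> real" where
  "maxnorm f = Max ((\<lambda>i. \<bar>f $ i\<bar>) ` {..<dim_vec f})"

text \<open>The convention \<open>0 log 0 = 0\<close> is met because the product with \<open>0\<close> vanishes.\<close>

definition entropy :: "(nat \<Rightarrow> real) \<Rightarrow> real vec \<Rightarrow> real" where
  "entropy dv f = (\<Sum>i<dim_vec f. f $ i * ln (f $ i) * dv i)"

text \<open>Derivatives at the end points of the time interval are one-sided.\<close>

definition solves_ode_on ::
  "nat \<Rightarrow> (nat \<Rightarrow> real vec \<Rightarrow> real) \<Rightarrow> real \<Rightarrow> real \<Rightarrow> (real \<Rightarrow> real vec) \<Rightarrow> bool" where
  "solves_ode_on N Q a b f \<longleftrightarrow>
     (\<forall>t\<in>{a..b}. f t \<in> carrier_vec N \<and>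
        (\<forall>i<N. ((\<lambda>s. f s $ i) has_real_derivative Q i (f t)) (at t within {a..b})))"

text \<open>
  The standing assumption on the system: solutions with nonnegative initial data conserve mass,
  stay nonnegative and have nonincreasing entropy. Monotonicity of the entropy is not stated
  through its derivative, which need not exist where a component of the solution vanishes.
\<close>

definition entropic_system ::
  "nat \<Rightarrow> (nat \<Rightarrow> real) \<Rightarrow> (nat \<Rightarrow> real vec \<Rightarrow> real) \<Rightarrow> bool" where
  "entropic_system N dv Q \<longleftrightarrow>
     (\<forall>a b f. a < b \<longrightarrow> solves_ode_on N Q a b f \<longrightarrow> f a \<in> nonneg_vecs N \<longrightarrow>
        (\<forall>t\<in>{a..b}.
           ((\<lambda>s. \<Sum>i<N. f s $ i * dv i) has_real_derivative 0) (at t within {a..b})) \<and>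
        (\<forall>t\<in>{a..b}. f t \<in> nonneg_vecs N) \<and>
        antimono_on {a..b} (\<lambda>t. entropy dv (f t)))"

end

theory Submission
  imports Defs "HOL-Analysis.L2_Norm"
begin

text \<open>
  Write $g = f^{n+1}$ and $h = f(t_{n+1})$. The entropy is convex along the segment from $g$ to
  $\mathbf 1$ and vanishes at $\mathbf 1$, so $\beta\,\eta(g) \le \eta(g) - \eta(h)$. Both sides
  are compared with norms: $\eta(g) \ge c\,\|\mathbf 1 - g\|_2^2$, since $x \log x - x + 1$ is
  quadratic near $1$ and $g$ has mean $1$; and, by the tangent inequality at $g$, conservation of
  mass and Cauchy--Schwarz, $\eta(g) - \eta(h) \le \sum_i \log g_i\,(g_i - h_i)\,\Delta v_i \le
  \|\log g\|_2\,\|h - g\|_2$ with $\|\log g\|_2 \le L\,\|\mathbf 1 - g\|_2$. Dividing by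
  $\|\mathbf 1 - g\|_2$ yields the claim with $M = L / c$.
\<close>

text \<open>Convexity in tangent form, from \<open>ln z <= z - 1\<close> at
  \<open>z = x / y\<close>, multiplied by \<open>y\<close>. At \<open>y = 0\<close> the left side
  collapses to \<open>- x\<close>.\<close>

lemma xlnx_tangent:
  fixes x y :: real
  assumes "0 < x" "0 \<le> y"
  shows "x * ln x + (ln x + 1) * (y - x) \<le> y * ln y"
proof (cases "y = 0")
  case True
  then show ?thesis using assms by (simp add: algebra_simps)
next
  case False
  then have y: "0 < y" using assms by simp
  have "y * ln (x / y) \<le> y * (x / y - 1)"
    using y assms by (intro mult_left_mono ln_le_minus_one) auto
  also have "\<dots> = x - y" using y by (simp add: field_simps)
  finally show ?thesis using y assms by (simp add: ln_div algebra_simps)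
qed

text \<open>Jensen's inequality: the tangent at \<open>u\<close> is evaluated at \<open>x\<close>
  and at \<open>1\<close> and averaged with weights \<open>1 - \<beta>\<close> and
  \<open>\<beta>\<close>. The slope terms cancel because \<open>u\<close> is that average, and the
  end point \<open>1\<close> contributes \<open>1 * ln 1 = 0\<close>.\<close>

lemma xlnx_segment_to_one:
  fixes x \<beta> :: real
  assumes "0 < x" "0 < \<beta>" "\<beta> \<le> 1"
  defines "u \<equiv> x + \<beta> * (1 - x)"
  shows "u * ln u \<le> (1 - \<beta>) * (x * ln x)"
proof -
  have u_eq: "u = (1 - \<beta>) * x + \<beta>" by (simp add: u_def algebra_simps)
  have u: "0 < u" unfolding u_eq using assms by (intro add_nonneg_pos mult_nonneg_nonneg) auto
  have "(1 - \<beta>) * (u * ln u + (ln u + 1) * (x - u)) \<le> (1 - \<beta>) * (x * ln x)"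
    using assms by (intro mult_left_mono xlnx_tangent[OF u]) auto
  moreover have "\<beta> * (u * ln u + (ln u + 1) * (1 - u)) \<le> \<beta> * (1 * ln 1)"
    using assms by (intro mult_left_mono xlnx_tangent[OF u]) auto
  moreover have "(1 - \<beta>) * (u * ln u + (ln u + 1) * (x - u)) + \<beta> * (u * ln u + (ln u + 1) * (1 - u))
      = u * ln u + (ln u + 1) * ((1 - \<beta>) * x + \<beta> - u)"
    by (simp add: algebra_simps)
  ultimately show ?thesis by (simp add: u_eq)
qed

text \<open>With \<open>s = sqrt x\<close>, the square factors as
  \<open>(s + 1)^2 * (s - 1)^2\<close>; the first factor is at most \<open>2 * (G + 1)\<close>, the
  second at most \<open>x * ln x - x + 1\<close>.\<close>

lemma xlnx_quadratic_lower_bound: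
  fixes x G :: real
  assumes "0 < x" "x \<le> G"
  shows "(x - 1)\<^sup>2 \<le> 2 * (G + 1) * (x * ln x - x + 1)"
proof -
  define s where "s = sqrt x"
  have s: "0 < s" "x = s\<^sup>2" using assms by (simp_all add: s_def)
  have "- ln s \<le> 1 / s - 1"
    using ln_le_minus_one[of "1 / s"] s by (simp add: ln_div)
  \<comment> \<open>Bounding \<open>ln\<close> at \<open>sqrt x\<close>, since at \<open>x\<close> itself it only gives \<open>0 \<le> x * ln x - x + 1\<close>.\<close>
  then have "2 * x * (1 - 1 / s) \<le> 2 * x * ln s"
    using assms by (intro mult_left_mono) auto
  moreover have "ln x = 2 * ln s" using s by (simp add: ln_realpow)
  moreover have "2 * x * (1 - 1 / s) = 2 * s\<^sup>2 - 2 * s"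
    using s by (simp add: field_simps power2_eq_square)
  ultimately have lower: "(s - 1)\<^sup>2 \<le> x * ln x - x + 1"
    using s by (simp add: power2_eq_square algebra_simps)
  have "(s + 1)\<^sup>2 \<le> (s + 1)\<^sup>2 + (s - 1)\<^sup>2" by simp
  also have "\<dots> = 2 * (x + 1)"
    using s by (simp add: power2_eq_square algebra_simps)
  also have "\<dots> \<le> 2 * (G + 1)" using assms by simp
  finally have "(s + 1)\<^sup>2 \<le> 2 * (G + 1)" .
  moreover have "(x - 1)\<^sup>2 = (s + 1)\<^sup>2 * (s - 1)\<^sup>2"
    using s by (simp add: power2_eq_square algebra_simps)
  ultimately show ?thesis
    using lower by (auto intro!: mult_mono order_trans[OF zero_le_power2])
qed

text \<open>The slope is \<open>1\<close> above \<open>1\<close> and at most \<open>1 / C\<close>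
  below; their sum serves both cases. Only here does the lower bound on the components enter the
  final constant.\<close>

lemma abs_ln_le:
  fixes x C :: real
  assumes "0 < C" "C \<le> x"
  shows "\<bar>ln x\<bar> \<le> (1 + 1 / C) * \<bar>x - 1\<bar>"
proof (cases "1 \<le> x")
  case True
  then have "\<bar>ln x\<bar> \<le> 1 * \<bar>x - 1\<bar>" using ln_le_minus_one[of x] by simp
  also have "\<dots> \<le> (1 + 1 / C) * \<bar>x - 1\<bar>" using assms by (intro mult_right_mono) auto
  finally show ?thesis .
next
  case False
  have x: "0 < x" using assms by simp
  have "\<bar>ln x\<bar> = ln (1 / x)" using x False by (simp add: ln_div)
  also have "\<dots> \<le> 1 / x - 1" using x by (intro ln_le_minus_one) auto
  also have "\<dots> = (1 / x) * \<bar>x - 1\<bar>" using x False by (simp add: field_simps)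
  also have "\<dots> \<le> (1 + 1 / C) * \<bar>x - 1\<bar>"
    using assms by (intro mult_right_mono add_increasing divide_left_mono) auto
  finally show ?thesis .
qed

lemma weighted_Cauchy_Schwarz:
  fixes a b w :: "'a \<Rightarrow> real"
  assumes "\<And>i. i \<in> I \<Longrightarrow> 0 \<le> w i"
  shows "(\<Sum>i\<in>I. \<bar>a i\<bar> * \<bar>b i\<bar> * w i)
    \<le> sqrt (\<Sum>i\<in>I. (a i)\<^sup>2 * w i) * sqrt (\<Sum>i\<in>I. (b i)\<^sup>2 * w i)"
proof -
  have "(\<Sum>i\<in>I. \<bar>a i\<bar> * \<bar>b i\<bar> * w i)
      = (\<Sum>i\<in>I. \<bar>a i * sqrt (w i)\<bar> * \<bar>b i * sqrt (w i)\<bar>)"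
    using assms by (intro sum.cong) (auto simp: abs_mult)
  also have "\<dots> \<le> L2_set (\<lambda>i. a i * sqrt (w i)) I * L2_set (\<lambda>i. b i * sqrt (w i)) I"
    by (rule L2_set_mult_ineq)
  also have "\<dots> = sqrt (\<Sum>i\<in>I. (a i)\<^sup>2 * w i) * sqrt (\<Sum>i\<in>I. (b i)\<^sup>2 * w i)"
    using assms by (simp add: L2_set_def power_mult_distrib)
  finally show ?thesis .
qed

text \<open>The analytic core, on plain functions: the solution enters through its sign, its mass
  and the entropy equation. In the notation above, \<open>2 * (G + 1)\<close> is 1/c and
  \<open>1 + 1 / C\<close> is L.\<close>

lemma entropy_correction_bound:
  fixes g h w :: "'a \<Rightarrow> real" and \<beta> C G :: real
  assumes w: "\<And>i. i \<in> I \<Longrightarrow> 0 \<le> w i"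
    and C: "0 < C" "\<And>i. i \<in> I \<Longrightarrow> C \<le> g i" and G: "0 \<le> G" "\<And>i. i \<in> I \<Longrightarrow> g i \<le> G"
    and h: "\<And>i. i \<in> I \<Longrightarrow> 0 \<le> h i"
    and mass: "(\<Sum>i\<in>I. g i * w i) = sum w I" "(\<Sum>i\<in>I. h i * w i) = sum w I"
    and \<beta>: "0 < \<beta>" "\<beta> \<le> 1"
    and ent: "(\<Sum>i\<in>I. (g i + \<beta> * (1 - g i)) * ln (g i + \<beta> * (1 - g i)) * w i)
      = (\<Sum>i\<in>I. h i * ln (h i) * w i)"
  shows "\<beta> * sqrt (\<Sum>i\<in>I. (1 - g i)\<^sup>2 * w i)
    \<le> 2 * (G + 1) * (1 + 1 / C) * sqrt (\<Sum>i\<in>I. (h i - g i)\<^sup>2 * w i)"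
proof -
  define d where "d = sqrt (\<Sum>i\<in>I. (1 - g i)\<^sup>2 * w i)"
  define e where "e = sqrt (\<Sum>i\<in>I. (h i - g i)\<^sup>2 * w i)"
  define \<eta> where "\<eta> = (\<lambda>f. \<Sum>i\<in>I. f i * ln (f i) * w i)"
  have g: "0 < g i" if "i \<in> I" for i using C that by force
  have d: "0 \<le> d" "d\<^sup>2 = (\<Sum>i\<in>I. (1 - g i)\<^sup>2 * w i)"
    using w by (simp_all add: d_def sum_nonneg)
  have e: "0 \<le> e" using w by (simp add: e_def sum_nonneg)
  \<comment> \<open>Reading \<open>ent\<close> from right to left turns \<open>\<eta> h\<close> into
    the entropy of the corrected state, which is bounded termwise.\<close>
  have "\<eta> h \<le> (\<Sum>i\<in>I. (1 - \<beta>) * (g i * ln (g i)) * w i)"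
    unfolding \<eta>_def ent[symmetric]
    by (intro sum_mono mult_right_mono xlnx_segment_to_one g w \<beta>)
  also have "\<dots> = (1 - \<beta>) * \<eta> g" by (simp add: \<eta>_def sum_distrib_left mult.assoc)
  finally have convex: "\<beta> * \<eta> g \<le> \<eta> g - \<eta> h" by (simp add: algebra_simps)
  have "d\<^sup>2 \<le> (\<Sum>i\<in>I. 2 * (G + 1) * (g i * ln (g i) - g i + 1) * w i)"
    unfolding d(2)
    by (intro sum_mono mult_right_mono w)
      (metis xlnx_quadratic_lower_bound g G(2) power2_commute)
  \<comment> \<open>The linear terms \<open>- g i + 1\<close> sum to zero by conservation of mass,
    leaving only the entropy of \<open>g\<close>.\<close>
  also have "\<dots> = 2 * (G + 1) * (\<eta> g - (\<Sum>i\<in>I. g i * w i) + sum w I)"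
    unfolding \<eta>_def sum_distrib_left sum.distrib[symmetric] sum_subtractf[symmetric]
    by (intro sum.cong) (auto simp: algebra_simps)
  finally have lower: "d\<^sup>2 \<le> 2 * (G + 1) * \<eta> g" by (simp add: mass)
  have "(\<Sum>i\<in>I. (g i * ln (g i) + (ln (g i) + 1) * (h i - g i)) * w i) \<le> \<eta> h"
    unfolding \<eta>_def by (intro sum_mono mult_right_mono xlnx_tangent g h w)
  \<comment> \<open>Equal masses remove the \<open>1\<close> from the slope
    \<open>ln (g i) + 1\<close>. This matters because \<open>ln (g i)\<close> alone is small when
    \<open>g i\<close> is near \<open>1\<close>.\<close>
  moreover have "(\<Sum>i\<in>I. (g i * ln (g i) + (ln (g i) + 1) * (h i - g i)) * w i)
      = \<eta> g - (\<Sum>i\<in>I. ln (g i) * (g i - h i) * w i)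
        + ((\<Sum>i\<in>I. h i * w i) - (\<Sum>i\<in>I. g i * w i))"
    unfolding \<eta>_def sum.distrib[symmetric] sum_subtractf[symmetric]
    by (intro sum.cong) (auto simp: algebra_simps)
  ultimately have "\<eta> g - \<eta> h \<le> (\<Sum>i\<in>I. ln (g i) * (g i - h i) * w i)"
    by (simp add: mass)
  \<comment> \<open>Trading the logarithm for the distance to \<open>1\<close> produces the factor
    \<open>d\<close> that is cancelled at the end.\<close>
  also have "\<dots> \<le> (\<Sum>i\<in>I. (1 + 1 / C) * (\<bar>1 - g i\<bar> * \<bar>h i - g i\<bar> * w i))"
  proof (intro sum_mono)
    fix i assume i: "i \<in> I"
    have "ln (g i) * (g i - h i) \<le> \<bar>ln (g i)\<bar> * \<bar>h i - g i\<bar>"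
      by (metis abs_ge_self abs_minus_commute abs_mult)
    also have "\<dots> \<le> (1 + 1 / C) * \<bar>1 - g i\<bar> * \<bar>h i - g i\<bar>"
      using abs_ln_le[OF C(1) C(2)[OF i]] by (intro mult_right_mono) (auto simp: abs_minus_commute)
    finally show "ln (g i) * (g i - h i) * w i
        \<le> (1 + 1 / C) * (\<bar>1 - g i\<bar> * \<bar>h i - g i\<bar> * w i)"
      using w[OF i] by (simp add: mult_right_mono flip: mult.assoc)
  qed
  also have "\<dots> \<le> (1 + 1 / C) * (d * e)"
    unfolding sum_distrib_left[symmetric] d_def e_def
    using C(1) by (intro mult_left_mono weighted_Cauchy_Schwarz w) auto
  finally have upper: "\<beta> * \<eta> g \<le> (1 + 1 / C) * (d * e)" using convex by linarith
  have "d * (\<beta> * d) = \<beta> * d\<^sup>2" by (simp add: power2_eq_square)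
  also have "\<dots> \<le> \<beta> * (2 * (G + 1) * \<eta> g)" using lower \<beta> by (intro mult_left_mono) auto
  also have "\<dots> = 2 * (G + 1) * (\<beta> * \<eta> g)" by simp
  also have "\<dots> \<le> 2 * (G + 1) * ((1 + 1 / C) * (d * e))"
    using upper G by (intro mult_left_mono) auto
  also have "\<dots> = d * (2 * (G + 1) * (1 + 1 / C) * e)" by simp
  finally have "d * (\<beta> * d) \<le> d * (2 * (G + 1) * (1 + 1 / C) * e)" .
  \<comment> \<open>For positive \<open>d\<close> the common factor cancels; for
    \<open>d = 0\<close> the left side vanishes and the right side is nonnegative.\<close>
  then have "\<beta> * d \<le> 2 * (G + 1) * (1 + 1 / C) * e"
    using d(1) e C(1) G(1) by (cases "d = 0") auto
  then show ?thesis by (simp add: d_def e_def)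
qed

lemma wnorm_1:
  assumes "f \<in> nonneg_vecs N" "\<forall>i<N. 0 < dv i"
  shows "wnorm 1 dv f = (\<Sum>i<N. f $ i * dv i)"
proof -
  have "(\<Sum>i<dim_vec f. \<bar>f $ i\<bar> powr 1 * dv i) = (\<Sum>i<N. f $ i * dv i)"
    using assms by (intro sum.cong) (auto simp: nonneg_vecs_def)
  moreover have "0 \<le> (\<Sum>i<N. f $ i * dv i)"
    using assms by (intro sum_nonneg mult_nonneg_nonneg) (auto simp: nonneg_vecs_def less_imp_le)
  ultimately show ?thesis by (simp add: wnorm_def)
qed

lemma wnorm_2:
  assumes "f \<in> carrier_vec N" "\<forall>i<N. 0 < dv i"
  shows "wnorm 2 dv f = sqrt (\<Sum>i<N. (f $ i)\<^sup>2 * dv i)"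
proof -
  have "0 \<le> (\<Sum>i<N. (f $ i)\<^sup>2 * dv i)"
    using assms by (intro sum_nonneg mult_nonneg_nonneg) (auto simp: less_imp_le)
  then show ?thesis using assms by (simp add: wnorm_def powr_half_sqrt)
qed

theorem theorem2p3:
  "\<exists>M :: real \<Rightarrow> real \<Rightarrow> real \<Rightarrow> real.
     (\<forall>x y z. 0 < M x y z) \<and>
     (\<forall>(N :: nat) (dv :: nat \<Rightarrow> real) (V :: real) (Q :: nat \<Rightarrow> real vec \<Rightarrow> real)
        (t0 :: real) (t1 :: real) (f0 :: real vec) (f :: real \<Rightarrow> real vec)
        (g :: real vec) (\<beta> :: real) (C0 :: real).
        1 \<le> N \<longrightarrow>
        (\<forall>i<N. 0 < dv i) \<longrightarrow>
        V = (\<Sum>i<N. dv i) \<longrightarrow>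
        entropic_system N dv Q \<longrightarrow>
        t0 < t1 \<longrightarrow>
        f0 \<in> nonneg_vecs N \<longrightarrow>
        wnorm 1 dv f0 = V \<longrightarrow>
        solves_ode_on N Q t0 t1 f \<longrightarrow>
        f t0 = f0 \<longrightarrow>
        g \<in> nonneg_vecs N \<longrightarrow>
        wnorm 1 dv g = wnorm 1 dv (f t1) \<longrightarrow>
        wnorm 1 dv (f t1) = V \<longrightarrow>
        entropy dv g > entropy dv f0 \<longrightarrow>
        0 < \<beta> \<longrightarrow>
        \<beta> \<le> 1 \<longrightarrow>
        entropy dv (g + \<beta> \<cdot>\<^sub>v (ones_vec N - g)) = entropy dv (f t1) \<longrightarrow>
        0 < C0 \<longrightarrow>
        (\<forall>i<N. C0 \<le> g $ i) \<longrightarrow>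
        wnorm 2 dv (\<beta> \<cdot>\<^sub>v (ones_vec N - g))
          \<le> M C0 (maxnorm g) (maxnorm (f t1)) * wnorm 2 dv (f t1 - g))"
proof (intro exI[of _ "\<lambda>C G _. 2 * (\<bar>G\<bar> + 1) * (1 + 1 / \<bar>C\<bar>)"] conjI allI impI)
  fix x y :: real
  \<comment> \<open>The absolute values keep the witness positive at all real arguments, including
    \<open>x = 0\<close>, where \<open>1 / 0 = 0\<close>.\<close>
  show "0 < 2 * (\<bar>y\<bar> + 1) * (1 + 1 / \<bar>x\<bar>)"
    by (intro mult_pos_pos add_nonneg_pos add_pos_nonneg) auto
next
  fix N :: nat and dv :: "nat \<Rightarrow> real" and V :: real and Q :: "nat \<Rightarrow> real vec \<Rightarrow> real"
    and t0 t1 :: real and f0 :: "real vec" and f :: "real \<Rightarrow> real vec"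
    and g :: "real vec" and \<beta> C0 :: real
  assume dv: "\<forall>i<N. 0 < dv i" and V: "V = (\<Sum>i<N. dv i)"
    and sys: "entropic_system N dv Q" "t0 < t1" "f0 \<in> nonneg_vecs N"
      "solves_ode_on N Q t0 t1 f" "f t0 = f0"
    and g: "g \<in> nonneg_vecs N"
    and mass: "wnorm 1 dv g = wnorm 1 dv (f t1)" "wnorm 1 dv (f t1) = V"
    and \<beta>: "0 < \<beta>" "\<beta> \<le> 1"
    and ent: "entropy dv (g + \<beta> \<cdot>\<^sub>v (ones_vec N - g)) = entropy dv (f t1)"
    and C0: "0 < C0" "\<forall>i<N. C0 \<le> g $ i"
  define h where "h = f t1"
  have h: "h \<in> nonneg_vecs N"
    using sys unfolding entropic_system_def h_def by fastforce
  have dims: "g \<in> carrier_vec N" "h \<in> carrier_vec N" "ones_vec N \<in> carrier_vec N"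
    using g h by (auto simp: nonneg_vecs_def ones_vec_def)
  have dim: "dim_vec g = N" "dim_vec h = N" "dim_vec (ones_vec N) = N"
    using dims by auto
  have "\<beta> * sqrt (\<Sum>i<N. (1 - g $ i)\<^sup>2 * dv i)
      \<le> 2 * (\<bar>maxnorm g\<bar> + 1) * (1 + 1 / C0) * sqrt (\<Sum>i<N. (h $ i - g $ i)\<^sup>2 * dv i)"
  proof (rule entropy_correction_bound)
    fix i assume i: "i \<in> {..<N}"
    show "0 \<le> dv i" "C0 \<le> g $ i" "0 \<le> h $ i"
      using i dv C0 h by (auto simp: nonneg_vecs_def less_imp_le)
    have "\<bar>g $ i\<bar> \<le> maxnorm g"
      unfolding maxnorm_def using i dim by (intro Max_ge) auto
    then show "g $ i \<le> \<bar>maxnorm g\<bar>" by linarith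
  next
    \<comment> \<open>On nonnegative vectors the 1-norm is the mass, so the norm hypotheses become
      linear identities.\<close>
    show "(\<Sum>i<N. g $ i * dv i) = sum dv {..<N}" "(\<Sum>i<N. h $ i * dv i) = sum dv {..<N}"
      using mass V wnorm_1[OF g dv] wnorm_1[OF h dv] by (simp_all add: h_def)
    show "(\<Sum>i<N. (g $ i + \<beta> * (1 - g $ i)) * ln (g $ i + \<beta> * (1 - g $ i)) * dv i)
        = (\<Sum>i<N. h $ i * ln (h $ i) * dv i)"
      using ent dim by (simp add: entropy_def h_def[symmetric]) (simp add: ones_vec_def)
  qed (use C0 \<beta> in auto)
  moreover have "wnorm 2 dv (\<beta> \<cdot>\<^sub>v (ones_vec N - g)) = \<beta> * sqrt (\<Sum>i<N. (1 - g $ i)\<^sup>2 * dv i)"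
  proof -
    have "(\<Sum>i<N. ((\<beta> \<cdot>\<^sub>v (ones_vec N - g)) $ i)\<^sup>2 * dv i)
        = \<beta>\<^sup>2 * (\<Sum>i<N. (1 - g $ i)\<^sup>2 * dv i)"
      unfolding sum_distrib_left using dim
      by (intro sum.cong) (auto simp: ones_vec_def power_mult_distrib)
    then show ?thesis using dims dv \<beta> by (simp add: wnorm_2[of _ N] real_sqrt_mult)
  qed
  moreover have "wnorm 2 dv (h - g) = sqrt (\<Sum>i<N. (h $ i - g $ i)\<^sup>2 * dv i)"
    using dims dv dim by (simp add: wnorm_2[of _ N])
  ultimately show "wnorm 2 dv (\<beta> \<cdot>\<^sub>v (ones_vec N - g))
      \<le> 2 * (\<bar>maxnorm g\<bar> + 1) * (1 + 1 / \<bar>C0\<bar>) * wnorm 2 dv (f t1 - g)"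
    using C0 by (simp add: h_def)
qed

end
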